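(* Let $G$ be a finite simple $2$-connected $3$-$\gamma_c$-vertex critical claw-free graph. Then $G$ is Hamiltonian.
   Context: A connected dominating set of a graph $G$ is a set $D \subseteq V(G)$ such that every vertex outside $D$ has a neighbor in $D$ and the induced subgraph $G[D]$ is connected; $\gamma_c(G)$ is the minimum size of a connected dominating set. A graph $G$ is $k$-$\gamma_c$-vertex critical if $\gamma_c(G)=k$ and $\gamma_c(G-v)<k$ for every vertex $v$ of $G$. A graph is claw-free if it has no induced subgraph isomorphic to $K_{1,3}$. *)

theory Defs
  imports "Graph_Theory.Graph_Theory" "HOL-Library.Extended_Nat"
begin

text \<open>
  Finite simple graphs are rendered by the locale \<open>graph\<close>: finite symmetric digraphs
  without loops and parallel arcs, so that each undirected edge is a pair of opposite arcs.
\<close>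

definition connected_dominating_set :: "('a, 'b) pre_digraph \<Rightarrow> 'a set \<Rightarrow> bool" where
  "connected_dominating_set G D \<longleftrightarrow>
     D \<subseteq> verts G \<and>
     (\<forall>v \<in> verts G - D. \<exists>u \<in> D. v \<rightarrow>\<^bsub>G\<^esub> u) \<and>
     Digraph_Component.connected (G \<restriction> D)"

text \<open>
  The value is \<open>\<infinity>\<close> if there is no connected dominating set, i.e. if the graph is not connected;
  for 2-connected graphs and their vertex-deleted subgraphs this does not occur.
\<close>

definition connected_domination_number :: "('a, 'b) pre_digraph \<Rightarrow> enat" (\<open>\<gamma>\<^sub>c\<close>) where
  "\<gamma>\<^sub>c G = (INF D \<in> {D. connected_dominating_set G D}. enat (card D))"

definition gamma_c_vertex_critical :: "nat \<Rightarrow> ('a, 'b) pre_digraph \<Rightarrow> bool" where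
  "gamma_c_vertex_critical k G \<longleftrightarrow>
     \<gamma>\<^sub>c G = enat k \<and> (\<forall>v \<in> verts G. \<gamma>\<^sub>c (pre_digraph.del_vert G v) < enat k)"

definition claw_free :: "('a, 'b) pre_digraph \<Rightarrow> bool" where
  "claw_free G \<longleftrightarrow> \<not> (\<exists>H. induced_subgraph H G \<and> K\<^bsub>1,3\<^esub> H)"

definition vertex_connected :: "nat \<Rightarrow> ('a, 'b) pre_digraph \<Rightarrow> bool" where
  "vertex_connected k G \<longleftrightarrow>
     card (verts G) > k \<and>
     (\<forall>X \<subseteq> verts G. card X < k \<longrightarrow> Digraph_Component.connected (G \<restriction> (verts G - X)))"

text \<open>
  A cycle of a symmetric digraph may consist of an arc followed by its opposite arc;
  the length bound excludes these, leaving exactly the cycles of the undirected graph.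
\<close>

definition hamiltonian :: "('a, 'b) pre_digraph \<Rightarrow> bool" where
  "hamiltonian G \<longleftrightarrow>
     (\<exists>p. pre_digraph.cycle G p \<and> length p \<ge> 3 \<and> tail G ` set p = verts G)"

end

theory Submission
  imports Defs
begin

text \<open>
  Deleting any vertex \<open>v\<close> yields adjacent vertices \<open>a\<close>, \<open>b\<close>, not adjacent to \<open>v\<close>, that
  dominate all other vertices. Put \<open>A = N(a) - N[b]\<close>, \<open>B = N(b) - N[a]\<close>, \<open>C = N(a) \<inter> N(b)\<close>.
  As the graph is claw-free, \<open>A \<union> {a}\<close> and \<open>B \<union> {b}\<close> are cliques and neither \<open>A \<union> C\<close> nor
  \<open>B \<union> C\<close> contains three independent vertices; as no edge dominates the graph, \<open>A\<close> and \<open>B\<close>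
  are nonempty. If \<open>v\<close> has neighbours in both \<open>A\<close> and \<open>B\<close>, the cycle runs through
  \<open>v, A, a, C, b, B\<close>, where \<open>C\<close> is traceable or splits into two cliques, one of which can be
  inserted between \<open>A\<close> and \<open>a\<close>. Otherwise \<open>v\<close> has, by symmetry, no neighbour in \<open>B\<close>; then no
  neighbour of \<open>v\<close> has one either, and \<open>C\<close> decomposes further. The cycle is glued from
  paths through these pieces and \<open>A\<close>, \<open>B\<close>, using that neither \<open>a\<close> nor \<open>b\<close> is a cut vertex.
\<close>

section \<open>Paths, cliques and independence number at most two\<close>

locale simple_graph =
  fixes V :: "'a set" and E :: "'a \<Rightarrow> 'a \<Rightarrow> bool"
  assumes finite_V: "finite V"
    and E_sym: "E x y \<Longrightarrow> E y x"
    and E_irrefl: "\<not> E x x"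
    and E_in_V: "E x y \<Longrightarrow> x \<in> V"
begin

definition clique :: "'a set \<Rightarrow> bool" where
  "clique K \<longleftrightarrow> (\<forall>x\<in>K. \<forall>y\<in>K. x \<noteq> y \<longrightarrow> E x y)"

definition spanning_path :: "'a set \<Rightarrow> 'a \<Rightarrow> 'a \<Rightarrow> bool" where
  "spanning_path X x y \<longleftrightarrow>
     (\<exists>xs. xs \<noteq> [] \<and> distinct xs \<and> set xs = X \<and> successively E xs \<and> hd xs = x \<and> last xs = y)"

definition spanning_cycle :: bool where
  "spanning_cycle \<longleftrightarrow> (\<exists>x y. spanning_path V x y \<and> E y x)"

definition alpha_le_2 :: "'a set \<Rightarrow> bool" where
  "alpha_le_2 X \<longleftrightarrow>
     (\<forall>x\<in>X. \<forall>y\<in>X. \<forall>z\<in>X. x \<noteq> y \<and> y \<noteq> z \<and> x \<noteq> z \<longrightarrow> E x y \<or> E y z \<or> E x z)"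

lemma alpha_le_2D:
  assumes "alpha_le_2 X" "x \<in> X" "y \<in> X" "z \<in> X" "x \<noteq> y" "y \<noteq> z" "x \<noteq> z" "\<not> E x y" "\<not> E x z"
  shows "E y z"
  using assms unfolding alpha_le_2_def by blast

lemma spanning_cycleI:
  assumes "spanning_path X x y" "E y x" "X = V"
  shows spanning_cycle
  using assms by (auto simp: spanning_cycle_def)

lemma spanning_path_single: "spanning_path {x} x x"
  unfolding spanning_path_def by (rule exI[of _ "[x]"]) auto

lemma spanning_path_ends: "spanning_path X x y \<Longrightarrow> x \<in> X" "spanning_path X x y \<Longrightarrow> y \<in> X"
  unfolding spanning_path_def by (metis hd_in_set, metis last_in_set)

text \<open>Concatenation of the two vertex lists: the gluing step from which all cycles below are
  assembled.\<close>

lemma spanning_path_join: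
  assumes "spanning_path X x y" "E y x'" "spanning_path Y x' y'" "X \<inter> Y = {}"
  shows "spanning_path (X \<union> Y) x y'"
proof -
  obtain xs where xs: "xs \<noteq> []" "distinct xs" "set xs = X" "successively E xs" "hd xs = x" "last xs = y"
    using assms(1) by (auto simp: spanning_path_def)
  obtain ys where ys: "ys \<noteq> []" "distinct ys" "set ys = Y" "successively E ys" "hd ys = x'" "last ys = y'"
    using assms(3) by (auto simp: spanning_path_def)
  show ?thesis unfolding spanning_path_def
    by (rule exI[of _ "xs @ ys"]) (use xs ys assms in \<open>auto simp: successively_append_iff\<close>)
qed

lemma spanning_path_snoc:
  assumes "spanning_path X x y" "E y z" "z \<notin> X"
  shows "spanning_path (insert z X) x z"
  using spanning_path_join[OF assms(1,2) spanning_path_single] assms(3) by simp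

lemma spanning_path_rev: "spanning_path X x y \<Longrightarrow> spanning_path X y x"
  unfolding spanning_path_def
  by (elim exE, rule_tac x = "rev xs" in exI)
     (auto simp: hd_rev last_rev elim: successively_mono intro: E_sym)

lemma clique_subset: "clique K \<Longrightarrow> L \<subseteq> K \<Longrightarrow> clique L"
  by (auto simp: clique_def)

lemma clique_insert:
  assumes "clique K" "\<And>x. x \<in> K \<Longrightarrow> E a x"
  shows "clique (insert a K)"
  unfolding clique_def
proof (intro ballI impI)
  fix x y assume "x \<in> insert a K" "y \<in> insert a K" "x \<noteq> y"
  then show "E x y"
    using assms(1)[unfolded clique_def] assms(2)[of y] E_sym[OF assms(2)[of x]] by auto
qed

text \<open>Every ordering of a clique is a path, so both ends can be prescribed; they may coincide
  only if the clique is a single vertex.\<close>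

lemma spanning_path_clique:
  assumes "finite K" "clique K" "x \<in> K" "y \<in> K" "x \<noteq> y \<or> K = {x}"
  shows "spanning_path K x y"
proof -
  have enum: "successively E xs" if "distinct xs" "set xs \<subseteq> K" for xs
    using that
  proof (induction xs)
    case (Cons z zs)
    then show ?case using assms(2) by (cases zs) (auto simp: clique_def)
  qed auto
  show ?thesis
  proof (cases "x = y")
    case True
    then show ?thesis using assms spanning_path_single by auto
  next
    case False
    obtain zs where zs: "set zs = K - {x,y}" "distinct zs"
      using finite_distinct_list assms(1) by (metis finite_Diff)
    show ?thesis unfolding spanning_path_def
      by (rule exI[of _ "x # zs @ [y]"], intro conjI enum) (use zs False assms in auto)
  qed
qed

lemma clique_path_to:
  assumes "finite K" "clique K" "y \<in> K"
  obtains x where "x \<in> K" "spanning_path K x y"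
proof (cases "K = {y}")
  case True
  then show ?thesis using that spanning_path_single by auto
next
  case False
  then obtain x where "x \<in> K" "x \<noteq> y" using assms by auto
  then show ?thesis using that spanning_path_clique assms by auto
qed

lemma clique_path_from:
  assumes "finite K" "clique K" "x \<in> K"
  obtains y where "y \<in> K" "spanning_path K x y"
  using clique_path_to[OF assms] spanning_path_rev by metis

text \<open>
  A vertex missed by a longest path is adjacent to neither end, so the ends are adjacent; hence
  the path closes to a cycle, and the missed vertex has no neighbour on it.
\<close>

lemma alpha_le_2_traceable_or_two_cliques:
  assumes fin: "finite D" and alpha: "alpha_le_2 D" and ne: "D \<noteq> {}"
  obtains (path) x y where "spanning_path D x y"
  | (split) D1 D2 where "D = D1 \<union> D2" "D1 \<inter> D2 = {}" "D1 \<noteq> {}" "D2 \<noteq> {}"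
      "clique D1" "clique D2" "\<And>x y. x \<in> D1 \<Longrightarrow> y \<in> D2 \<Longrightarrow> \<not> E x y"
proof -
  define P where "P = (\<lambda>X. X \<subseteq> D \<and> (\<exists>x y. spanning_path X x y))"
  obtain d where "d \<in> D" using ne by auto
  then have "P {d}" using spanning_path_single by (auto simp: P_def)
  then obtain X where PX: "P X" and max: "\<And>Y. P Y \<Longrightarrow> card Y \<le> card X"
    using ex_has_greatest_nat[of P "{d}" card "Suc (card D)"] fin
    by (metis P_def card_mono less_Suc_eq_le)
  have maxX: False if "P Y" "X \<subset> Y" for Y
    using max[OF that(1)] psubset_card_mono[of Y X] that fin
    by (metis P_def finite_subset not_less)
  obtain x y where xy: "spanning_path X x y" using PX by (auto simp: P_def)
  then obtain xs where xs: "xs \<noteq> []" "distinct xs" "set xs = X" "successively E xs"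
    "hd xs = x" "last xs = y" by (auto simp: spanning_path_def)
  have XD: "X \<subseteq> D" using PX by (auto simp: P_def)
  have xX: "x \<in> X" "y \<in> X" using xs by auto
  show ?thesis
  proof (cases "X = D")
    case True
    then show ?thesis using path xy by blast
  next
    case False
    have noend: "\<not> E q z" if "z \<in> D - X" "spanning_path X p q" for z p q
    proof
      assume "E q z"
      then have "spanning_path (insert z X) p z"
        using spanning_path_snoc[OF that(2)] that(1) by auto
      then have "P (insert z X)" using that XD by (auto simp: P_def)
      then show False using maxX[of "insert z X"] that(1) by blast
    qed
    have anti: "\<not> E p z" if z: "z \<in> D - X" and p: "p \<in> X" for p z
    proof
      assume "E p z"
      have "\<not> E y z" "\<not> E x z" using noend[OF z] xy spanning_path_rev by blast+
      then have "E y x \<or> x = y" using alpha z xX XD E_sym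
        unfolding alpha_le_2_def by (metis Diff_iff subsetD)
      obtain us vs where uv: "xs = us @ p # vs" using p xs by (metis split_list)
      have "\<exists>q. spanning_path X q p" if "vs \<noteq> []"
      proof -
        have "E y x" using \<open>E y x \<or> x = y\<close> xs uv that by (cases us) auto
        \<comment> \<open>The edge from \<open>y\<close> to \<open>x\<close> closes the path to a
          cycle, which is cut open just behind \<open>p\<close>, so that \<open>p\<close> becomes an
          end.\<close>
        have "spanning_path X (hd vs) p" unfolding spanning_path_def
          by (rule exI[of _ "vs @ us @ [p]"])
             (use xs uv that \<open>E y x\<close> in \<open>auto simp: successively_append_iff successively_Cons hd_append split: if_splits\<close>)
        then show ?thesis by blast
      qed
      moreover have "spanning_path X x p" if "vs = []" using that uv xs xy by auto
      ultimately show False using noend[OF z] \<open>E p z\<close> by blast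
    qed
    \<comment> \<open>Two nonadjacent vertices on one side and any vertex of the other side would be
      independent.\<close>
    show ?thesis
    proof (rule split[of X "D - X"])
      obtain z where z: "z \<in> D - X" using False XD by blast
      show "clique X" unfolding clique_def
      proof (intro ballI impI)
        fix p q assume "p \<in> X" "q \<in> X" "p \<noteq> q"
        then show "E p q"
          using alpha[unfolded alpha_le_2_def, rule_format, of p q z] anti[OF z] z XD by auto
      qed
      show "clique (D - X)" unfolding clique_def
      proof (intro ballI impI)
        fix p q assume "p \<in> D - X" "q \<in> D - X" "p \<noteq> q"
        then show "E p q"
          using alpha[unfolded alpha_le_2_def, rule_format, of p q x] anti[OF _ xX(1)] xX XD E_sym
          by blast
      qed
    qed (use XD xX False anti in auto)
  qed
qed

text \<open>If \<open>D\<close> is traceable, the path runs through \<open>b\<close>,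
  \<open>B\<close>, \<open>D\<close>. Otherwise \<open>D\<close> consists of two cliques and the
  nonempty set \<open>B\<close> bridges them, in the order \<open>b\<close>, \<open>D2\<close>,
  \<open>B\<close>, \<open>D1\<close>.\<close>

lemma spanning_path_through:
  assumes fin: "finite D" "finite B" and alpha: "alpha_le_2 D" and ne: "D \<noteq> {}" "B \<noteq> {}"
    and cl: "clique (insert b B)" and compl: "\<And>x y. x \<in> D \<Longrightarrow> y \<in> insert b B \<Longrightarrow> E x y"
    and disj: "insert b B \<inter> D = {}" "b \<notin> B"
  obtains d where "d \<in> D" "spanning_path (insert b B \<union> D) b d"
proof -
  have compl': "E y x" if "x \<in> D" "y \<in> insert b B" for x y
    using compl[OF that] by (rule E_sym)
  from fin(1) alpha ne(1) show thesis
  proof (cases rule: alpha_le_2_traceable_or_two_cliques)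
    case (path x y)
    obtain z where z: "z \<in> insert b B" "spanning_path (insert b B) b z"
      using clique_path_from[OF _ cl, of b] fin by auto
    have "x \<in> D" "y \<in> D" using spanning_path_ends[OF path] .
    moreover have "spanning_path (insert b B \<union> D) b y"
      using spanning_path_join[OF z(2) _ path] compl z(1) \<open>x \<in> D\<close> disj compl' by blast
    ultimately show thesis using that by blast
  next
    case (split D1 D2)
    obtain x y z where xyz: "x \<in> D1" "y \<in> D2" "z \<in> B" using split ne by blast
    have f: "finite D1" "finite D2" using fin split by auto
    obtain x' where x': "x' \<in> D1" "spanning_path D1 x' x"
      using clique_path_to[OF f(1) split(5) xyz(1)] .
    obtain y' where y': "y' \<in> D2" "spanning_path D2 y' y"
      using clique_path_to[OF f(2) split(6) xyz(2)] .
    obtain z' where z': "z' \<in> B" "spanning_path B z' z"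
      using clique_path_to[OF fin(2) _ xyz(3)] cl clique_subset by blast
    have "spanning_path ({b} \<union> D2) b y"
      by (rule spanning_path_join[OF spanning_path_single _ y'(2)])
         (use y' compl split disj compl' in blast)+
    then have "spanning_path ({b} \<union> D2 \<union> B) b z"
      by (rule spanning_path_join[OF _ _ z'(2)]) (use xyz z' compl split disj in blast)+
    then have "spanning_path ({b} \<union> D2 \<union> B \<union> D1) b x"
      by (rule spanning_path_join[OF _ _ x'(2)]) (use xyz x' compl split disj compl' in blast)+
    moreover have "{b} \<union> D2 \<union> B \<union> D1 = insert b B \<union> D" using split by auto
    ultimately show thesis using that xyz split by auto
  qed
qed

end

section \<open>Claw-free graphs with an edge dominating all vertices but one\<close>

text \<open>Connectedness after deleting \<open>x\<close> is phrased as an edge leaving every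
  nonempty proper part, since it serves below to produce such edges.\<close>

locale two_connected_claw_free_graph = simple_graph +
  assumes no_claw: "\<lbrakk>E c x; E c y; E c z; x \<noteq> y; y \<noteq> z; x \<noteq> z\<rbrakk> \<Longrightarrow> E x y \<or> E y z \<or> E x z"
    and no_cut_vertex: "\<lbrakk>x \<in> V; X \<subseteq> V - {x}; X \<noteq> {}; X \<noteq> V - {x}\<rbrakk>
          \<Longrightarrow> \<exists>p\<in>X. \<exists>q\<in>V - {x} - X. E p q"

text \<open>The pair \<open>a\<close>, \<open>b\<close> is a connected dominating set of the graph
  without \<open>v\<close>; by \<open>not_dom\<close> neither of the two vertices suffices
  alone.\<close>

locale almost_dominating_edge = two_connected_claw_free_graph +
  fixes v a b :: 'a
  assumes v: "v \<in> V" "\<not> E a v" "\<not> E b v" "a \<noteq> v" "b \<noteq> v"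
    and ab: "E a b"
    and dom: "x \<in> V \<Longrightarrow> x = v \<or> x = a \<or> x = b \<or> E a x \<or> E b x"
    and not_dom: "\<exists>x. E a x \<and> \<not> E b x \<and> x \<noteq> b" "\<exists>x. E b x \<and> \<not> E a x \<and> x \<noteq> a"
begin

definition "A = {x. E a x \<and> \<not> E b x \<and> x \<noteq> b}"
definition "B = {x. E b x \<and> \<not> E a x \<and> x \<noteq> a}"
definition "C = {x. E a x \<and> E b x}"

text \<open>The hypotheses are symmetric in \<open>a\<close> and \<open>b\<close>, so every result
  about \<open>B\<close> transfers to \<open>A\<close>, with \<open>C\<close> unchanged.\<close>

lemma swap: "almost_dominating_edge V E v b a"
  by unfold_locales (use v ab E_sym dom not_dom in blast)+

lemma ba: "E b a" using ab E_sym by blast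
lemma ab_ne: "a \<noteq> b" "b \<noteq> a" using ab E_irrefl by auto

lemma V_partition: "V = {v} \<union> insert a A \<union> insert b B \<union> C"
proof -
  have "E a x \<Longrightarrow> x \<in> V" "E b x \<Longrightarrow> x \<in> V" for x using E_in_V E_sym by blast+
  then show ?thesis using dom v ab ba by (auto simp: A_def B_def C_def)
qed

lemma disjoint:
  "A \<inter> B = {}" "A \<inter> C = {}" "B \<inter> C = {}"
  "v \<notin> A" "v \<notin> B" "v \<notin> C" "a \<notin> A" "a \<notin> B" "a \<notin> C" "b \<notin> A" "b \<notin> B" "b \<notin> C"
  using v E_irrefl by (auto simp: A_def B_def C_def)

lemma finite_parts: "finite A" "finite B" "finite C"
  using finite_V V_partition by (metis finite_Un finite_insert)+

lemma nonempty: "A \<noteq> {}" "B \<noteq> {}"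
  using not_dom by (auto simp: A_def B_def)

text \<open>Two nonadjacent vertices of \<open>A\<close> would form a claw at \<open>a\<close>
  together with \<open>b\<close>.\<close>

lemma clique_A: "clique (insert a A)"
  unfolding clique_def
  using no_claw[OF ab] E_sym by (auto simp: A_def)

lemma clique_B: "clique (insert b B)"
  unfolding clique_def
  using no_claw[OF ba] E_sym by (auto simp: B_def)

text \<open>All these vertices are neighbours of \<open>a\<close>, so three independent ones would
  form a claw.\<close>

lemma alpha_a: "alpha_le_2 (A \<union> C)"
  unfolding alpha_le_2_def
  using no_claw[of a] by (auto simp: A_def C_def)

lemma alpha_b: "alpha_le_2 (B \<union> C)"
  unfolding alpha_le_2_def
  using no_claw[of b] by (auto simp: B_def C_def)

lemma alpha_C: "alpha_le_2 C"
  using alpha_a by (auto simp: alpha_le_2_def)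

lemma C_adj: "c \<in> C \<Longrightarrow> E a c" "c \<in> C \<Longrightarrow> E b c" "c \<in> C \<Longrightarrow> E c a" "c \<in> C \<Longrightarrow> E c b"
  using E_sym by (auto simp: C_def)

lemma A_adj: "x \<in> A \<Longrightarrow> y \<in> insert a A \<Longrightarrow> x \<noteq> y \<Longrightarrow> E x y"
  using clique_A by (auto simp: clique_def)

lemma B_adj: "x \<in> B \<Longrightarrow> y \<in> insert b B \<Longrightarrow> x \<noteq> y \<Longrightarrow> E x y"
  using clique_B by (auto simp: clique_def)

lemma path_A: "w \<in> A \<Longrightarrow> spanning_path (insert a A) w a"
  using finite_parts(1) disjoint(7) by (intro spanning_path_clique clique_A) auto

lemma path_B: "z \<in> B \<Longrightarrow> spanning_path (insert b B) b z"
  using finite_parts(2) disjoint(11) by (intro spanning_path_clique clique_B) auto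

section \<open>Neighbours of \<open>v\<close> in both \<open>A\<close> and \<open>B\<close>\<close>

lemma spanning_cycle_if_v_meets_A_and_B:
  assumes u: "u \<in> A" "E v u" and w: "w \<in> B" "E v w"
  shows spanning_cycle
proof -
  \<comment> \<open>Every vertex of \<open>insert a C\<close> is adjacent to \<open>b\<close>, so
    such a path continues through \<open>b\<close> and \<open>B\<close> to \<open>w\<close> and
    closes at \<open>v\<close>.\<close>
  have "\<exists>y \<in> insert a C. spanning_path (insert a A \<union> C) u y"
  proof (cases "C = {}")
    case True
    then show ?thesis using path_A[OF u(1)] by auto
  next
    case False
    from finite_parts(3) alpha_C False show ?thesis
    proof (cases rule: alpha_le_2_traceable_or_two_cliques)
      case (path x y)
      have xy: "x \<in> C" "y \<in> C" using spanning_path_ends[OF path] .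
      from path_A[OF u(1)] have "spanning_path (insert a A \<union> C) u y"
        by (rule spanning_path_join[OF _ _ path]) (use xy C_adj disjoint in auto)
      then show ?thesis using xy by auto
    next
      case (split C1 C2)
      \<comment> \<open>\<open>t\<close> is to be the last vertex of a path through \<open>A\<close>
        that starts at \<open>u\<close>.\<close>
      obtain t where t: "t \<in> A" "t \<noteq> u \<or> A = {u}" using u by auto
      have pt: "spanning_path A u t"
        using spanning_path_clique[OF finite_parts(1) clique_subset[OF clique_A]] t u by auto
      \<comment> \<open>A clique \<open>D1\<close> completely joined to \<open>t\<close> is inserted
        between \<open>A\<close> and \<open>a\<close>; the other clique follows
        \<open>a\<close>.\<close>
      have main: ?thesis
        if D: "C = D1 \<union> D2" "D1 \<inter> D2 = {}" "D1 \<noteq> {}" "D2 \<noteq> {}" "clique D1" "clique D2"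
          "\<And>x. x \<in> D1 \<Longrightarrow> E t x" for D1 D2
      proof -
        have f: "finite D1" "finite D2" using D finite_parts by auto
        obtain x where x: "x \<in> D1" using D by auto
        obtain y where y: "y \<in> D2" using D by auto
        obtain x' where x': "x' \<in> D1" "spanning_path D1 x' x"
          using clique_path_to[OF f(1) D(5) x] .
        obtain y' where y': "y' \<in> D2" "spanning_path D2 y' y"
          using clique_path_to[OF f(2) D(6) y] .
        have "spanning_path (A \<union> D1) u x"
          by (rule spanning_path_join[OF pt _ x'(2)]) (use x' D disjoint in auto)
        then have "spanning_path (insert a (A \<union> D1)) u a"
          by (rule spanning_path_snoc) (use x C_adj D disjoint in auto)
        then have "spanning_path (insert a (A \<union> D1) \<union> D2) u y"
          by (rule spanning_path_join[OF _ _ y'(2)]) (use y' C_adj D disjoint in auto)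
        moreover have "insert a (A \<union> D1) \<union> D2 = insert a A \<union> C" using D by auto
        ultimately show ?thesis using y D by auto
      qed
      \<comment> \<open>Otherwise \<open>t\<close> and a nonneighbour of it from each clique would
        be three independent vertices of \<open>A \<union> C\<close>.\<close>
      have "(\<forall>x\<in>C1. E t x) \<or> (\<forall>x\<in>C2. E t x)"
      proof (rule ccontr)
        assume "\<not> ?thesis"
        then obtain x y where xy: "x \<in> C1" "y \<in> C2" "\<not> E t x" "\<not> E t y" by blast
        have "E x y"
          by (rule alpha_le_2D[OF alpha_a _ _ _ _ _ _ xy(3,4)]) (use xy split t disjoint in auto)
        then show False using split(7) xy by blast
      qed
      then show ?thesis
        using main[of C1 C2] main[of C2 C1] split by (metis Int_commute Un_commute)
    qed
  qed
  then obtain y where y: "y \<in> insert a C" "spanning_path (insert a A \<union> C) u y" by auto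
  have "spanning_path (insert a A \<union> C \<union> insert b B) u w"
    by (rule spanning_path_join[OF y(2) _ path_B[OF w(1)]]) (use y ab ab_ne C_adj disjoint in auto)
  then have "spanning_path (insert v (insert a A \<union> C \<union> insert b B)) u v"
    by (rule spanning_path_snoc) (use E_sym[OF w(2)] v disjoint in auto)
  then show ?thesis by (rule spanning_cycleI) (use u V_partition in auto)
qed

section \<open>Decomposition of \<open>C\<close> when \<open>v\<close> has no neighbour in
  \<open>B\<close>\<close>

text \<open>The rest of \<open>C\<close> is split by whether a vertex is joined to all of
  \<open>S\<close>. If \<open>v\<close> misses \<open>B\<close> and \<open>S\<close> is nonempty,
  \<open>S \<union> T1\<close> is a clique, while \<open>T2\<close> is completely joined to
  \<open>B\<close>.\<close>

definition "S = {x \<in> C. E v x}"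
definition "T1 = {x \<in> C - S. \<forall>s\<in>S. E x s}"
definition "T2 = {x \<in> C - S. \<not> (\<forall>s\<in>S. E x s)}"

lemma C_partition: "C = S \<union> T1 \<union> T2" "S \<inter> T1 = {}" "S \<inter> T2 = {}" "T1 \<inter> T2 = {}"
  by (auto simp: S_def T1_def T2_def)

lemma finite_STT: "finite S" "finite T1" "finite T2"
  using finite_parts C_partition by auto

lemma S_adj: "s \<in> S \<Longrightarrow> E v s" "s \<in> S \<Longrightarrow> E s v" "s \<in> S \<Longrightarrow> s \<in> C" "s \<in> S \<Longrightarrow> t \<in> T1 \<Longrightarrow> E s t"
    "s \<in> S \<Longrightarrow> t \<in> T1 \<Longrightarrow> E t s"
  using E_sym by (auto simp: S_def T1_def)

lemma T_in_C: "t \<in> T1 \<Longrightarrow> t \<in> C" "t \<in> T2 \<Longrightarrow> t \<in> C"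
  by (auto simp: T1_def T2_def)

lemma v_nbr_in: "E v x \<Longrightarrow> x \<in> A \<union> B \<union> C"
  using V_partition E_in_V[OF E_sym, of v x] v E_irrefl E_sym[of v x] by auto

lemma AB_not_adj: "x \<in> B \<Longrightarrow> \<not> E a x" "x \<in> B \<Longrightarrow> \<not> E x a" "x \<in> A \<Longrightarrow> \<not> E b x" "x \<in> A \<Longrightarrow> \<not> E x b"
  using E_sym by (auto simp: A_def B_def)

context
  assumes vB: "\<And>x. x \<in> B \<Longrightarrow> \<not> E v x"
begin

text \<open>\<open>x\<close> is adjacent to \<open>a\<close>, so \<open>v\<close>, \<open>a\<close>, \<open>z\<close> would form a claw at \<open>x\<close>.\<close>

lemma v_nbr_not_adj_B:
  assumes "E v x" "z \<in> B"
  shows "\<not> E x z" "\<not> E z x"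
proof -
  have "x \<in> A \<union> C" using v_nbr_in assms vB by blast
  then have xa: "E x a" using C_adj(3) E_sym by (auto simp: A_def)
  show "\<not> E x z"
  proof
    assume "E x z"
    then show False
      using no_claw[OF E_sym[OF assms(1)] xa, of z] v vB[OF assms(2)] AB_not_adj assms(2) disjoint E_sym
      by metis
  qed
  then show "\<not> E z x" using E_sym by blast
qed

text \<open>A vertex of \<open>B\<close> has no neighbour in \<open>S\<close>, so with two
  nonadjacent vertices of \<open>S\<close> it would be an independent triple in
  \<open>B \<union> C\<close>.\<close>

lemma clique_S: "clique S"
  unfolding clique_def
proof (intro ballI impI)
  fix x y assume xy: "x \<in> S" "y \<in> S" "x \<noteq> y"
  obtain z where z: "z \<in> B" using nonempty by auto
  show "E x y"
    by (rule alpha_le_2D[OF alpha_b, of z])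
       (use xy z v_nbr_not_adj_B(2)[OF S_adj(1)] S_adj(3) disjoint(3) in blast)+
qed

text \<open>Some \<open>s\<close> in \<open>S\<close> is adjacent neither to \<open>t\<close> nor to
  \<open>z\<close>; as \<open>B \<union> C\<close> has no independent triple, \<open>t\<close> and
  \<open>z\<close> are adjacent.\<close>

lemma T2_adj_B:
  assumes "t \<in> T2" "z \<in> B"
  shows "E t z"
proof -
  obtain s where s: "s \<in> S" "\<not> E t s" using assms by (auto simp: T2_def)
  show ?thesis
    by (rule alpha_le_2D[OF alpha_b, of s])
       (use assms s E_sym[of s t] v_nbr_not_adj_B(1)[OF S_adj(1)] S_adj(3) T_in_C(2) disjoint(3)
          C_partition(3) in blast)+
qed

text \<open>Two nonadjacent vertices of \<open>T1\<close> would form a claw with \<open>v\<close> at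
  any vertex of \<open>S\<close>.\<close>

lemma clique_S_T1:
  assumes "S \<noteq> {}"
  shows "clique (S \<union> T1)"
proof -
  obtain s where s: "s \<in> S" using assms by auto
  have "E x y" if "x \<in> T1" "y \<in> T1" "x \<noteq> y" for x y
  proof -
    have "\<not> E v x" "\<not> E v y" using that by (auto simp: T1_def S_def)
    then show ?thesis
      using no_claw[of s v x y] s that S_adj T_in_C disjoint by blast
  qed
  then show ?thesis using clique_S S_adj unfolding clique_def by blast
qed

text \<open>\<open>T2\<close> is completely joined to \<open>insert b B\<close>, so
  \<open>spanning_path_through\<close> applies. The end in \<open>T2\<close> lies in
  \<open>C\<close> and is thus adjacent to \<open>a\<close>.\<close>

lemma B_T2_path:
  assumes "T2 \<noteq> {}"
  obtains d where "d \<in> T2" "spanning_path (insert b B \<union> T2) b d"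
proof (rule spanning_path_through[OF finite_STT(3) finite_parts(2) _ assms nonempty(2) clique_B])
  show "alpha_le_2 T2" using alpha_C C_partition(1) by (auto simp: alpha_le_2_def)
  show "E x y" if "x \<in> T2" "y \<in> insert b B" for x y
    using that T2_adj_B T_in_C C_adj by blast
  show "insert b B \<inter> T2 = {}" "b \<notin> B" using disjoint T_in_C by auto
qed (rule that)

end

text \<open>As \<open>b\<close> is not a cut vertex, some edge leaves \<open>B\<close> without using
  \<open>b\<close>.\<close>

lemma B_crossing:
  obtains z q where "z \<in> B" "E z q" "q \<in> {v} \<union> insert a A \<union> C"
proof -
  have "\<exists>p\<in>B. \<exists>q\<in>V - {b} - B. E p q"
    by (rule no_cut_vertex) (use V_partition disjoint nonempty v in auto)
  then show ?thesis using that V_partition by auto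
qed

section \<open>Neighbours of \<open>v\<close> in \<open>C\<close> only\<close>

text \<open>A nonempty \<open>T2\<close> links \<open>B\<close> to \<open>A\<close>, giving the
  cycle \<open>S\<close> with \<open>v\<close>, \<open>T1\<close>, \<open>b\<close>,
  \<open>B\<close> with \<open>T2\<close>, \<open>A\<close>, \<open>a\<close>. If \<open>T2\<close>
  is empty, an edge between \<open>B\<close> and \<open>A\<close> takes over this role. Failing
  that, the edges leaving \<open>A\<close> and \<open>B\<close> end at distinct vertices of
  \<open>T1\<close>.\<close>

lemma spanning_cycle_if_v_meets_C_only:
  assumes vB: "\<And>x. x \<in> B \<Longrightarrow> \<not> E v x" and vA: "\<And>x. x \<in> A \<Longrightarrow> \<not> E v x"
    and s: "s \<in> S" "s' \<in> S" "s \<noteq> s'"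
  shows spanning_cycle
proof -
  interpret sw: almost_dominating_edge V E v b a by (rule swap)
  have sw_eq: "sw.A = B" "sw.B = A" "sw.C = C" "sw.S = S" "sw.T2 = T2"
    unfolding sw.A_def sw.B_def sw.C_def A_def B_def C_def S_def sw.S_def T2_def sw.T2_def by auto
  have T2A: "E t w" if "t \<in> T2" "w \<in> A" for t w
    using sw.T2_adj_B that vA unfolding sw_eq by blast
  have SA: "\<not> E x z" "\<not> E z x" if "x \<in> S" "z \<in> A" for x z
    using sw.v_nbr_not_adj_B[of x z] that vA S_adj unfolding sw_eq by blast+
  have SB: "\<not> E x z" "\<not> E z x" if "x \<in> S" "z \<in> B" for x z
    using v_nbr_not_adj_B[of x z] that vB S_adj by blast+
  have clST: "clique (S \<union> T1)" using clique_S_T1 vB s by blast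
  have pS: "spanning_path (insert v S) s s'"
    by (rule spanning_path_clique)
       (use s finite_STT clique_S[OF vB] S_adj in \<open>auto simp: clique_def\<close>)
  \<comment> \<open>Both ends lie in \<open>C\<close>, hence the path can be continued at
    \<open>b\<close> and closed at \<open>a\<close>.\<close>
  have pST: "\<exists>y\<in>S \<union> T1. spanning_path (insert v (S \<union> T1)) s y"
  proof (cases "T1 = {}")
    case True
    then show ?thesis using pS s by auto
  next
    case False
    then obtain t where t: "t \<in> T1" by auto
    obtain t' where t': "t' \<in> T1" "spanning_path T1 t' t"
      using clique_path_to[OF finite_STT(2) clique_subset[OF clST] t] by auto
    have "spanning_path (insert v S \<union> T1) s t"
      by (rule spanning_path_join[OF pS _ t'(2)])
         (use t' s S_adj C_partition T_in_C disjoint in auto)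
    then show ?thesis using t by auto
  qed
  then obtain y where y: "y \<in> S \<union> T1" "spanning_path (insert v (S \<union> T1)) s y" by auto
  have yC: "y \<in> C" using y C_partition by auto
  show ?thesis
  proof (cases "T2 = {}")
    case False
    obtain d where d: "d \<in> T2" "spanning_path (insert b B \<union> T2) b d"
      using B_T2_path[OF vB False] by blast
    obtain w where w: "w \<in> A" using nonempty by auto
    have "spanning_path (insert v (S \<union> T1) \<union> (insert b B \<union> T2)) s d"
      by (rule spanning_path_join[OF y(2) _ d(2)])
         (use yC C_adj C_partition disjoint v S_adj T_in_C in auto)
    then have "spanning_path (insert v (S \<union> T1) \<union> (insert b B \<union> T2) \<union> insert a A) s a"
      by (rule spanning_path_join[OF _ _ path_A[OF w]])
         (use T2A[OF d(1) w] C_partition disjoint v ab_ne S_adj T_in_C in auto)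
    then show ?thesis
      by (rule spanning_cycleI) (use s S_adj C_adj C_partition V_partition in auto)
  next
    case T2: True
    have C: "C = S \<union> T1" using T2 C_partition by auto
    show ?thesis
    proof (cases "\<exists>w\<in>A. \<exists>z\<in>B. E z w")
      case True
      then obtain w z where wz: "w \<in> A" "z \<in> B" "E z w" by auto
      have "spanning_path (insert v (S \<union> T1) \<union> insert b B) s z"
        by (rule spanning_path_join[OF y(2) _ path_B[OF wz(2)]])
           (use yC C_adj C disjoint v in auto)
      then have "spanning_path (insert v (S \<union> T1) \<union> insert b B \<union> insert a A) s a"
        by (rule spanning_path_join[OF _ _ path_A[OF wz(1)]])
           (use wz C disjoint v ab_ne in auto)
      then show ?thesis
        by (rule spanning_cycleI) (use s S_adj C_adj C V_partition in auto)
    next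
      case False
      obtain z t' where z: "z \<in> B" "E z t'" "t' \<in> {v} \<union> insert a A \<union> C" by (rule B_crossing)
      then have t': "t' \<in> T1" using C SB[of t' z] False AB_not_adj vB E_sym[of z] by blast
      obtain w t where w: "w \<in> A" "E w t" "t \<in> {v} \<union> insert b B \<union> C"
        using sw.B_crossing unfolding sw_eq by blast
      then have t: "t \<in> T1" using C SA[of t w] False AB_not_adj vA E_sym[of w] by blast
      \<comment> \<open>A common vertex would be the centre of a claw with leaves \<open>w\<close>,
        \<open>z\<close> and \<open>s\<close>.\<close>
      have "t \<noteq> t'"
      proof
        assume "t = t'"
        then show False
          using no_claw[OF E_sym[OF w(2)] _ S_adj(5)[OF s(1) t], of z] E_sym[OF z(2)] E_sym[of w z]
            z(1) w(1) SA(2)[OF s(1) w(1)] SB(2)[OF s(1) z(1)] False S_adj(3)[OF s(1)] disjoint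
          by (metis disjoint_iff)
      qed
      have clT: "clique (T1 - {t})" using clST clique_subset by blast
      obtain x where x: "x \<in> T1 - {t}" "spanning_path (T1 - {t}) x t'"
        using clique_path_to[OF _ clT, of t'] t' \<open>t \<noteq> t'\<close> finite_STT by auto
      \<comment> \<open>The cycle is \<open>a\<close>, \<open>A\<close> up to \<open>w\<close>,
        \<open>t\<close>, then \<open>S\<close> with \<open>v\<close>, the rest of \<open>T1\<close>
        up to \<open>t'\<close>, then \<open>z\<close>, \<open>B\<close>, \<open>b\<close>.\<close>
      have "spanning_path (insert t (insert a A)) a t"
        by (rule spanning_path_snoc[OF spanning_path_rev[OF path_A[OF w(1)]] w(2)])
           (use t T_in_C disjoint in auto)
      then have "spanning_path (insert t (insert a A) \<union> insert v S) a s'"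
        by (rule spanning_path_join[OF _ _ pS])
           (use s t S_adj C C_partition disjoint v in auto)
      then have "spanning_path (insert t (insert a A) \<union> insert v S \<union> (T1 - {t})) a t'"
        by (rule spanning_path_join[OF _ _ x(2)])
           (use s x S_adj C C_partition disjoint in auto)
      then have "spanning_path (insert t (insert a A) \<union> insert v S \<union> (T1 - {t}) \<union> insert b B) a b"
        by (rule spanning_path_join[OF _ _ spanning_path_rev[OF path_B[OF z(1)]]])
           (use E_sym[OF z(2)] t C v disjoint ab_ne in auto)
      then show ?thesis
        by (rule spanning_cycleI) (use ba t C V_partition in auto)
    qed
  qed
qed

section \<open>Neighbours of \<open>v\<close> in \<open>A\<close> and in \<open>C\<close>, none in
  \<open>B\<close>\<close>

text \<open>\<open>v\<close> closes a path from \<open>s\<close> to \<open>u\<close> through all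
  other vertices. It begins with \<open>S\<close> and \<open>T1\<close>, then visits
  \<open>b\<close>, \<open>B\<close>, \<open>T2\<close>, \<open>a\<close>, \<open>A\<close>. If
  \<open>T2\<close> is empty, it either crosses from \<open>B\<close> to \<open>A\<close> by an
  edge, or enters \<open>B\<close> from \<open>T1\<close> and passes from \<open>b\<close> to
  \<open>a\<close>.\<close>

lemma spanning_cycle_if_v_meets_A_and_C:
  assumes vB: "\<And>x. x \<in> B \<Longrightarrow> \<not> E v x" and u: "u \<in> A" "E v u" and s: "s \<in> S"
  shows spanning_cycle
proof -
  have clST: "clique (S \<union> T1)" using clique_S_T1 vB s by blast
  have fST: "finite (S \<union> T1)" using finite_STT by simp
  have "u \<noteq> a" using u disjoint by auto
  have pA: "spanning_path (insert a A) w u" if "w \<in> insert a A" "w \<noteq> u" for w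
    using spanning_path_clique[OF _ clique_A, of w u] that u finite_parts by auto
  have finish: spanning_cycle if "spanning_path X s u" "insert v X = V" "v \<notin> X" for X
  proof -
    have "spanning_path (insert v X) s v"
      by (rule spanning_path_snoc[OF that(1)]) (use E_sym[OF u(2)] that in auto)
    then show ?thesis by (rule spanning_cycleI) (use s S_adj that in auto)
  qed
  obtain y where y: "y \<in> S \<union> T1" "spanning_path (S \<union> T1) s y"
    using clique_path_from[OF fST clST, of s] s by auto
  have yC: "y \<in> C" using y C_partition by auto
  show ?thesis
  proof (cases "T2 = {}")
    case False
    obtain d where d: "d \<in> T2" "spanning_path (insert b B \<union> T2) b d"
      using B_T2_path[OF vB False] by blast
    have "spanning_path (S \<union> T1 \<union> (insert b B \<union> T2)) s d"
      by (rule spanning_path_join[OF y(2) _ d(2)])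
         (use yC C_adj C_partition disjoint S_adj T_in_C in auto)
    then have "spanning_path (S \<union> T1 \<union> (insert b B \<union> T2) \<union> insert a A) s u"
      by (rule spanning_path_join[OF _ _ pA[of a]])
         (use d C_adj \<open>u \<noteq> a\<close> C_partition disjoint ab_ne S_adj T_in_C in auto)
    then show ?thesis
      by (rule finish) (use C_partition V_partition disjoint v in auto)
  next
    case T2: True
    have C: "C = S \<union> T1" using T2 C_partition by auto
    show ?thesis
    proof (cases "\<exists>w\<in>A. \<exists>z\<in>B. E z w")
      case True
      then obtain w z where wz: "w \<in> A" "z \<in> B" "E z w" by auto
      then have "w \<noteq> u" using v_nbr_not_adj_B[OF vB] u by blast
      have "spanning_path (S \<union> T1 \<union> insert b B) s z"
        by (rule spanning_path_join[OF y(2) _ path_B[OF wz(2)]])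
           (use yC C_adj C disjoint in auto)
      then have "spanning_path (S \<union> T1 \<union> insert b B \<union> insert a A) s u"
        by (rule spanning_path_join[OF _ _ pA[of w]])
           (use wz \<open>w \<noteq> u\<close> C disjoint ab_ne in auto)
      then show ?thesis
        by (rule finish) (use C V_partition disjoint v in auto)
    next
      case False
      obtain z t where z: "z \<in> B" "E z t" "t \<in> {v} \<union> insert a A \<union> C" by (rule B_crossing)
      then have t: "t \<in> T1"
        using C v_nbr_not_adj_B[OF vB, of t z] S_adj False AB_not_adj vB E_sym[of z] by blast
      have "spanning_path (S \<union> T1) s t"
        by (rule spanning_path_clique[OF fST clST]) (use s t C_partition in auto)
      then have "spanning_path (S \<union> T1 \<union> insert b B) s b"
        by (rule spanning_path_join[OF _ _ spanning_path_rev[OF path_B[OF z(1)]]])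
           (use E_sym[OF z(2)] C disjoint in auto)
      then have "spanning_path (S \<union> T1 \<union> insert b B \<union> insert a A) s u"
        by (rule spanning_path_join[OF _ _ pA[of a]])
           (use ba \<open>u \<noteq> a\<close> C disjoint ab_ne in auto)
      then show ?thesis
        by (rule finish) (use C V_partition disjoint v in auto)
    qed
  qed
qed

section \<open>Neighbours of \<open>v\<close> in \<open>A\<close> only\<close>

text \<open>Deleting \<open>a\<close> leaves \<open>v\<close> a neighbour \<open>x\<close>; deleting
  \<open>x\<close> leaves it another one.\<close>

lemma v_two_nbrs:
  obtains x y where "E v x" "E v y" "x \<noteq> y"
proof -
  have "a \<in> V" "b \<in> V" using E_in_V ab ba by auto
  have "\<exists>p\<in>{v}. \<exists>q\<in>V - {a} - {v}. E p q"
    by (rule no_cut_vertex) (use v \<open>a \<in> V\<close> \<open>b \<in> V\<close> ab_ne in auto)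
  then obtain x where x: "E v x" by auto
  have "\<exists>p\<in>{v}. \<exists>q\<in>V - {x} - {v}. E p q"
    by (rule no_cut_vertex)
       (use v x E_irrefl E_sym[OF x] E_in_V[OF E_sym[OF x]] \<open>a \<in> V\<close> in auto)
  then show ?thesis using that x by auto
qed

text \<open>\<open>u\<close> splits \<open>C\<close> into two cliques: its neighbours, as
  \<open>v\<close> would otherwise complete a claw at \<open>u\<close>, and its nonneighbours, as
  \<open>A \<union> C\<close> has no independent triple. The cycle leaves \<open>v\<close> by
  \<open>u\<close> and returns by \<open>u'\<close>.\<close>

lemma spanning_cycle_if_v_meets_A_only_and_edge:
  assumes vB: "\<And>x. x \<in> B \<Longrightarrow> \<not> E v x" and vC: "\<And>x. x \<in> C \<Longrightarrow> \<not> E v x"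
    and u: "u \<in> A" "E v u" and u': "u' \<in> A" "E v u'" and "u \<noteq> u'"
    and edge: "(\<exists>w\<in>A. \<exists>z\<in>B. E z w) \<or> (\<exists>c\<in>C. E u c)"
  shows spanning_cycle
proof -
  define N where "N x = {c \<in> C. E x c}" for x
  have finN: "finite (N x)" "finite (C - N x)" for x using finite_parts by (auto simp: N_def)
  have NC: "c \<in> N x \<Longrightarrow> c \<in> C" "c \<in> N x \<Longrightarrow> E x c" for c x by (auto simp: N_def)
  have clN: "clique (insert a (N x))" if x: "E v x" for x
  proof -
    have "clique (N x)"
      unfolding clique_def
    proof (intro ballI impI)
      fix c d assume cd: "c \<in> N x" "d \<in> N x" "c \<noteq> d"
      then have "E v c \<or> E c d \<or> E v d"
        by (intro no_claw[OF E_sym[OF x]]) (use NC disjoint(6) in auto)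
      then show "E c d" using vC NC cd by blast
    qed
    then show ?thesis by (rule clique_insert) (use C_adj NC in auto)
  qed
  have clQ: "clique (C - N x)" if x: "x \<in> A" for x
    unfolding clique_def
  proof (intro ballI impI)
    fix c d assume "c \<in> C - N x" "d \<in> C - N x" "c \<noteq> d"
    then show "E c d"
      by (intro alpha_le_2D[OF alpha_a, of x]) (use x disjoint(2) in \<open>auto simp: N_def\<close>)
  qed
  have clQ_a: "clique (insert a (C - N x))" and clQ_b: "clique (insert b (C - N x))" if "x \<in> A" for x
    using clique_insert[OF clQ[OF that]] C_adj by auto
  have clA: "clique (A - {x})" and clB: "clique B" for x
    using clique_A clique_B clique_subset by blast+
  have pA: "spanning_path (A - {u}) w u'" if "w \<in> A - {u}" "w \<noteq> u'" for w
    by (rule spanning_path_clique) (use clA that u' \<open>u \<noteq> u'\<close> finite_parts in auto)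
  have vu: "spanning_path {v, u} v u"
    using spanning_path_snoc[OF spanning_path_single u(2)] u disjoint by (auto simp: insert_commute)
  have finish: spanning_cycle if "spanning_path X v u'" "X = V" for X
    using spanning_cycleI[OF that(1) E_sym[OF u'(2)] that(2)] .
  have nB: "\<not> E z x" if "z \<in> B" "E v x" for x z using v_nbr_not_adj_B[OF vB] that by blast
  show ?thesis
  proof (cases "\<exists>w\<in>A. \<exists>z\<in>B. E z w")
    case True
    then obtain w z where wz: "w \<in> A" "z \<in> B" "E z w" by auto
    \<comment> \<open>Neighbours of \<open>v\<close> have no neighbour in \<open>B\<close>. The
      cycle will be \<open>v\<close>, \<open>u\<close>, \<open>N u\<close>, \<open>a\<close>,
      \<open>C - N u\<close>, \<open>b\<close>, \<open>B\<close> up to \<open>z\<close>, then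
      \<open>A - {u}\<close> from \<open>w\<close> to \<open>u'\<close>.\<close>
    have w: "w \<in> A - {u}" "w \<noteq> u'" using nB[OF wz(2)] u u' wz by blast+
    obtain x where x: "x \<in> insert a (N u)" "spanning_path (insert a (N u)) x a"
      using clique_path_to[OF _ clN[OF u(2)], of a] finN by auto
    obtain y where y: "y \<in> insert b (C - N u)" "spanning_path (insert b (C - N u)) y b"
      using clique_path_to[OF _ clQ_b[OF u(1)], of b] finN by auto
    obtain z' where z': "z' \<in> B" "spanning_path B z' z"
      using clique_path_to[OF finite_parts(2) clB wz(2)] .
    have "spanning_path ({v, u} \<union> insert a (N u)) v a"
      by (rule spanning_path_join[OF vu _ x(2)])
         (use x u A_adj[of u a] NC disjoint v in auto)
    then have "spanning_path ({v, u} \<union> insert a (N u) \<union> insert b (C - N u)) v b"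
      by (rule spanning_path_join[OF _ _ y(2)])
         (use y ab C_adj u NC disjoint v ab_ne in auto)
    then have "spanning_path ({v, u} \<union> insert a (N u) \<union> insert b (C - N u) \<union> B) v z"
      by (rule spanning_path_join[OF _ _ z'(2)])
         (use B_adj[OF z'(1), of b] E_sym[of z' b] z'(1) u NC disjoint in auto)
    then have "spanning_path ({v, u} \<union> insert a (N u) \<union> insert b (C - N u) \<union> B \<union> (A - {u})) v u'"
      by (rule spanning_path_join[OF _ wz(3) pA[OF w]])
         (use NC disjoint in auto)
    then show ?thesis by (rule finish) (use V_partition u NC in auto)
  next
    case noAB: False
    obtain z c where zq: "z \<in> B" "E z c" "c \<in> {v} \<union> insert a A \<union> C" by (rule B_crossing)
    then have c: "c \<in> C" using noAB vB[of z] E_sym[of z v] AB_not_adj by blast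
    obtain x' where x': "x' \<in> A - {u}" "spanning_path (A - {u}) x' u'"
      using clique_path_to[OF _ clA, of u u'] u' \<open>u \<noteq> u'\<close> finite_parts by auto
    have ax': "E a x'" using x'(1) by (auto simp: A_def)
    have pBr: "spanning_path (insert b B) z b" using spanning_path_rev[OF path_B[OF zq(1)]] .
    have Nu: "N u \<noteq> {}" using noAB edge by (auto simp: N_def)
    show ?thesis
    proof (cases "c \<in> N u")
      case True
      \<comment> \<open>The order is \<open>v\<close>, \<open>u\<close>, \<open>N u\<close> up to
        \<open>c\<close>, then \<open>z\<close>, \<open>B\<close>, \<open>b\<close>,
        \<open>C - N u\<close>, \<open>a\<close>, \<open>A - {u}\<close>.\<close>
      obtain n where n: "n \<in> N u" "spanning_path (N u) n c"
        using clique_path_to[OF finN(1) clique_subset[OF clN[OF u(2)]] True] by auto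
      obtain y where y: "y \<in> insert a (C - N u)" "spanning_path (insert a (C - N u)) y a"
        using clique_path_to[OF _ clQ_a[OF u(1)], of a] finN by auto
      have "spanning_path ({v, u} \<union> N u) v c"
        by (rule spanning_path_join[OF vu _ n(2)]) (use n u NC disjoint in auto)
      then have "spanning_path ({v, u} \<union> N u \<union> insert b B) v b"
        by (rule spanning_path_join[OF _ E_sym[OF zq(2)] pBr]) (use u NC disjoint v in auto)
      then have "spanning_path ({v, u} \<union> N u \<union> insert b B \<union> insert a (C - N u)) v a"
        by (rule spanning_path_join[OF _ _ y(2)])
           (use y ba C_adj u NC disjoint v ab_ne in auto)
      then have "spanning_path ({v, u} \<union> N u \<union> insert b B \<union> insert a (C - N u) \<union> (A - {u})) v u'"
        by (rule spanning_path_join[OF _ ax' x'(2)]) (use NC disjoint in auto)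
      then show ?thesis by (rule finish) (use V_partition u NC in auto)
    next
      case cQ: False
      \<comment> \<open>Now \<open>B\<close> is traversed in the other direction, from
        \<open>b\<close> to \<open>z\<close>, and \<open>C - N u\<close> is entered at
        \<open>c\<close>.\<close>
      obtain m where m: "m \<in> N u" using Nu by auto
      obtain n where n: "n \<in> N u" "spanning_path (N u) n m"
        using clique_path_to[OF finN(1) clique_subset[OF clN[OF u(2)]] m] by auto
      have pQ: "spanning_path (insert a (C - N u)) c a"
        by (rule spanning_path_clique) (use clQ_a[OF u(1)] finN cQ c disjoint in auto)
      have "spanning_path ({v, u} \<union> N u) v m"
        by (rule spanning_path_join[OF vu _ n(2)]) (use n u NC disjoint in auto)
      then have "spanning_path ({v, u} \<union> N u \<union> insert b B) v z"
        by (rule spanning_path_join[OF _ C_adj(4)[OF NC(1)[OF m]] path_B[OF zq(1)]])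
           (use u NC disjoint v in auto)
      then have "spanning_path ({v, u} \<union> N u \<union> insert b B \<union> insert a (C - N u)) v a"
        by (rule spanning_path_join[OF _ zq(2) pQ])
           (use u NC disjoint v ab_ne in auto)
      then have "spanning_path ({v, u} \<union> N u \<union> insert b B \<union> insert a (C - N u) \<union> (A - {u})) v u'"
        by (rule spanning_path_join[OF _ ax' x'(2)]) (use NC disjoint in auto)
      then show ?thesis by (rule finish) (use V_partition u NC in auto)
    qed
  qed
qed

text \<open>In the remaining case the neighbours of \<open>v\<close> have no neighbour in
  \<open>C\<close>, so another vertex \<open>w\<close> of \<open>A\<close> must reach
  \<open>C\<close>. The cycle is \<open>v\<close>, \<open>y\<close>, \<open>A - {x}\<close> up to
  \<open>w\<close>, \<open>C\<close>, \<open>B\<close>, \<open>b\<close>, \<open>a\<close>,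
  \<open>x\<close>.\<close>

lemma spanning_cycle_if_v_meets_A_only:
  assumes vB: "\<And>x. x \<in> B \<Longrightarrow> \<not> E v x" and vC: "\<And>x. x \<in> C \<Longrightarrow> \<not> E v x"
  shows spanning_cycle
proof -
  obtain x y where xy: "E v x" "E v y" "x \<noteq> y" by (rule v_two_nbrs)
  then have xyA: "x \<in> A" "y \<in> A" using v_nbr_in vB vC by blast+
  show ?thesis
  proof (cases "(\<exists>w\<in>A. \<exists>z\<in>B. E z w) \<or> (\<exists>u\<in>A. E v u \<and> (\<exists>c\<in>C. E u c))")
    case True
    then obtain u where u: "u \<in> A" "E v u" "(\<exists>w\<in>A. \<exists>z\<in>B. E z w) \<or> (\<exists>c\<in>C. E u c)"
      using xy xyA by blast
    moreover obtain u' where "u' \<in> A" "E v u'" "u \<noteq> u'" using xy xyA by (cases "u = x") auto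
    ultimately show ?thesis using spanning_cycle_if_v_meets_A_only_and_edge[OF vB vC] by blast
  next
    case False
    \<comment> \<open>As \<open>a\<close> is not a cut vertex, an edge leaves
      \<open>insert v A\<close> elsewhere; it can only lead from a nonneighbour of \<open>v\<close>
      in \<open>A\<close> to \<open>C\<close>.\<close>
    have "\<exists>p\<in>insert v A. \<exists>q\<in>V - {a} - insert v A. E p q"
      by (rule no_cut_vertex) (use V_partition disjoint nonempty v ab_ne in auto)
    then obtain w d where w: "w \<in> insert v A" "d \<in> V - {a} - insert v A" "E w d" by auto
    have "d \<in> C" using w V_partition v_nbr_in vB vC False E_sym[OF w(3)] AB_not_adj by blast
    then have wA: "w \<in> A" "\<not> E v w" using w vC False by blast+
    obtain z c where z: "z \<in> B" "E z c" "c \<in> {v} \<union> insert a A \<union> C" by (rule B_crossing)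
    then have c: "c \<in> C" using False vB[of z] E_sym[of z v] AB_not_adj by blast
    \<comment> \<open>\<open>x\<close> has no neighbour in \<open>C\<close>, so two nonadjacent
      vertices of \<open>C\<close> would complete an independent triple with it.\<close>
    have clC: "clique C"
      unfolding clique_def
    proof (intro ballI impI)
      fix p q assume "p \<in> C" "q \<in> C" "p \<noteq> q"
      then show "E p q"
        by (intro alpha_le_2D[OF alpha_a, of x]) (use xy xyA False disjoint(2) in auto)
    qed
    have pA: "spanning_path (A - {x}) y w"
      by (rule spanning_path_clique[OF _ clique_subset[OF clique_A]])
         (use xy xyA wA finite_parts in auto)
    have "spanning_path ({v} \<union> (A - {x})) v w"
      by (rule spanning_path_join[OF spanning_path_single xy(2) pA]) (use disjoint in auto)
    then have start: "spanning_path (insert v (A - {x})) v w" by simp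
    have pBr: "spanning_path (insert b B) z b" using spanning_path_rev[OF path_B[OF z(1)]] .
    have finish: spanning_cycle if X: "spanning_path X v a" "X = V - {x}" for X
    proof -
      have "spanning_path (insert x X) v x"
        by (rule spanning_path_snoc[OF X(1)]) (use xyA X in \<open>auto simp: A_def\<close>)
      then show ?thesis
        by (rule spanning_cycleI) (use E_sym[OF xy(1)] E_in_V[OF E_sym[OF xy(1)]] X in auto)
    qed
    show ?thesis
    proof (cases "d = c")
      case True
      \<comment> \<open>Only \<open>c\<close> can be visited between \<open>A\<close> and
        \<open>B\<close>; the rest of \<open>C\<close> goes between \<open>b\<close> and
        \<open>a\<close>.\<close>
      have clCa: "clique (insert a (C - {c}))"
        by (rule clique_insert[OF clique_subset[OF clC]]) (use C_adj in auto)
      obtain y' where y': "y' \<in> insert a (C - {c})" "spanning_path (insert a (C - {c})) y' a"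
        using clique_path_to[OF _ clCa, of a] finite_parts by auto
      have "spanning_path (insert c (insert v (A - {x}))) v c"
        by (rule spanning_path_snoc[OF start]) (use w True c disjoint in auto)
      then have "spanning_path (insert c (insert v (A - {x})) \<union> insert b B) v b"
        by (rule spanning_path_join[OF _ E_sym[OF z(2)] pBr]) (use c disjoint v in auto)
      then have "spanning_path (insert c (insert v (A - {x})) \<union> insert b B \<union> insert a (C - {c})) v a"
        by (rule spanning_path_join[OF _ _ y'(2)])
           (use y' ba C_adj c disjoint v ab_ne in auto)
      then show ?thesis
        by (rule finish) (use V_partition xyA c disjoint in auto)
    next
      case False
      have "spanning_path C d c"
        by (rule spanning_path_clique) (use clC \<open>d \<in> C\<close> c False finite_parts in auto)
      then have "spanning_path (insert v (A - {x}) \<union> C) v c"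
        by (rule spanning_path_join[OF start w(3)]) (use disjoint in auto)
      then have "spanning_path (insert v (A - {x}) \<union> C \<union> insert b B) v b"
        by (rule spanning_path_join[OF _ E_sym[OF z(2)] pBr]) (use disjoint v in auto)
      then have "spanning_path (insert a (insert v (A - {x}) \<union> C \<union> insert b B)) v a"
        by (rule spanning_path_snoc) (use ba ab_ne v disjoint in auto)
      then show ?thesis
        by (rule finish) (use V_partition xyA disjoint in auto)
    qed
  qed
qed

section \<open>Combination of the cases\<close>

lemma spanning_cycle_if_v_not_meets_B:
  assumes vB: "\<And>x. x \<in> B \<Longrightarrow> \<not> E v x"
  shows spanning_cycle
proof -
  obtain x y where xy: "E v x" "E v y" "x \<noteq> y" by (rule v_two_nbrs)
  then have in_AC: "x \<in> A \<union> C" "y \<in> A \<union> C" using v_nbr_in vB by blast+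
  show ?thesis
  proof (cases "\<exists>u\<in>A. E v u")
    case True
    then obtain u where u: "u \<in> A" "E v u" by auto
    show ?thesis
    proof (cases "S = {}")
      case True
      then have vC: "\<not> E v c" if "c \<in> C" for c using that by (auto simp: S_def)
      then show ?thesis using spanning_cycle_if_v_meets_A_only[OF vB] by blast
    next
      case False
      then show ?thesis using spanning_cycle_if_v_meets_A_and_C[OF vB u] by blast
    qed
  next
    case False
    then have "x \<in> S" "y \<in> S" using in_AC xy by (auto simp: S_def)
    then show ?thesis using spanning_cycle_if_v_meets_C_only[OF vB] False xy by blast
  qed
qed

text \<open>\<open>v\<close> meets both \<open>A\<close> and \<open>B\<close>, or misses
  \<open>B\<close>, or misses \<open>A\<close>; the last case is the second with \<open>a\<close>
  and \<open>b\<close> exchanged.\<close>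

theorem spanning_cycle: spanning_cycle
proof -
  interpret sw: almost_dominating_edge V E v b a by (rule swap)
  have sw_eq: "sw.B = A" unfolding sw.B_def A_def by auto
  show ?thesis
    using spanning_cycle_if_v_meets_A_and_B spanning_cycle_if_v_not_meets_B
      sw.spanning_cycle_if_v_not_meets_B unfolding sw_eq by blast
qed

end

section \<open>Translation between digraphs and adjacency relations\<close>

text \<open>A walk from \<open>X\<close> to its complement in \<open>W\<close> leaves
  \<open>X\<close> at some step; by symmetry of \<open>G\<close> this step is an arc of
  \<open>G\<close>.\<close>

lemma connected_crossing_arc:
  assumes con: "Digraph_Component.connected (G \<restriction> W)"
    and X: "X \<subseteq> W" "X \<noteq> {}" "X \<noteq> W" and sym: "symmetric G"
  obtains p q where "p \<in> X" "q \<in> W - X" "p \<rightarrow>\<^bsub>G\<^esub> q"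
proof -
  obtain p q where pq: "p \<in> X" "q \<in> W - X" using X by blast
  have "p \<rightarrow>\<^sup>*\<^bsub>with_proj (mk_symmetric (G \<restriction> W))\<^esub> q"
    using con pq X by (auto simp: connected_def strongly_connected_def)
  then have "(p, q) \<in> rtrancl_on W (parcs (mk_symmetric (G \<restriction> W)))"
    by (simp add: reachable_def)
  then have "\<exists>p\<in>X. \<exists>q\<in>W - X. (p, q) \<in> parcs (mk_symmetric (G \<restriction> W))"
    using pq(2) by (induction rule: rtrancl_on_induct) (use pq(1) in auto)
  then obtain p q where "p \<in> X" "q \<in> W - X" "(p, q) \<in> parcs (mk_symmetric (G \<restriction> W))" by blast
  moreover from this(3) have "p \<rightarrow>\<^bsub>G\<^esub> q"
    using arcs_ends_symmetric[OF sym] by (auto simp: mk_symmetric_def arcs_ends_conv)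
  ultimately show thesis using that by blast
qed

lemma connected_induce_pair:
  assumes "x \<rightarrow>\<^bsub>G\<^esub> y"
  shows "Digraph_Component.connected (G \<restriction> {x, y})"
proof -
  have "(x, y) \<in> parcs (mk_symmetric (G \<restriction> {x, y}))" "(y, x) \<in> parcs (mk_symmetric (G \<restriction> {x, y}))"
    using assms by (auto simp: mk_symmetric_def arcs_ends_conv)
  then show ?thesis
    unfolding connected_def strongly_connected_def reachable_def
    by (auto intro: rtrancl_on_into_rtrancl_on[OF rtrancl_on_refl])
qed

lemma connected_domination_number_le:
  "connected_dominating_set G D \<Longrightarrow> \<gamma>\<^sub>c G \<le> enat (card D)"
  unfolding connected_domination_number_def by (intro INF_lower) simp

lemma connected_domination_number_less:
  assumes "\<gamma>\<^sub>c G < enat k"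
  obtains D where "connected_dominating_set G D" "card D < k"
  using assms unfolding connected_domination_number_def by (auto simp: INF_less_iff)

context graph begin

lemma adj_sym: "x \<rightarrow>\<^bsub>G\<^esub> y \<Longrightarrow> y \<rightarrow>\<^bsub>G\<^esub> x"
  using arcs_ends_symmetric[OF sym_arcs] .

lemma simple_graph_verts: "simple_graph (verts G) (\<lambda>x y. x \<rightarrow>\<^bsub>G\<^esub> y)"
proof
  show "x \<in> verts G" if "x \<rightarrow>\<^bsub>G\<^esub> y" for x y using that by auto
qed (use adj_sym adj_not_same in auto)

text \<open>If the three neighbours were independent, the arcs induced on the four vertices would be
  exactly those joining \<open>c\<close> to the others, which makes a claw.\<close>

lemma claw_free_adj:
  assumes "claw_free G" "c \<rightarrow>\<^bsub>G\<^esub> x" "c \<rightarrow>\<^bsub>G\<^esub> y" "c \<rightarrow>\<^bsub>G\<^esub> z" "x \<noteq> y" "y \<noteq> z" "x \<noteq> z"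
  shows "x \<rightarrow>\<^bsub>G\<^esub> y \<or> y \<rightarrow>\<^bsub>G\<^esub> z \<or> x \<rightarrow>\<^bsub>G\<^esub> z"
proof (rule ccontr)
  assume no: "\<not> ?thesis"
  let ?H = "G \<restriction> {c, x, y, z}"
  have inV: "{c, x, y, z} \<subseteq> verts G" using assms by auto
  have ne: "c \<noteq> x" "c \<noteq> y" "c \<noteq> z" using assms adj_not_same by auto
  have ind: "induced_subgraph ?H G" using inV by (rule induced_induce)
  have gr: "graph ?H"
    using digraphI_induced[OF ind] induced_graph_imp_graph[OF ind]
    by (simp add: graph_def pseudo_graph_def digraph_def)
  have ends: "arcs_ends ?H = {c} \<times> {x, y, z} \<union> {x, y, z} \<times> {c}"
  proof -
    have "arcs_ends ?H = {(p, q). p \<rightarrow>\<^bsub>G\<^esub> q \<and> p \<in> {c, x, y, z} \<and> q \<in> {c, x, y, z}}"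
      by (auto simp: arcs_ends_conv)
    moreover have "\<not> y \<rightarrow>\<^bsub>G\<^esub> x" "\<not> z \<rightarrow>\<^bsub>G\<^esub> y" "\<not> z \<rightarrow>\<^bsub>G\<^esub> x" using no adj_sym by blast+
    moreover have "\<not> w \<rightarrow>\<^bsub>G\<^esub> w" for w using adj_not_same by blast
    ultimately show ?thesis using no assms(2-4) adj_sym[OF assms(2)] adj_sym[OF assms(3)]
        adj_sym[OF assms(4)] by auto
  qed
  have "verts ?H = {c} \<union> {x, y, z}" "{c} \<inter> {x, y, z} = {}" "card {c} = 1" "card {x, y, z} = 3"
    using ne assms(5-7) by auto
  then have "K\<^bsub>1,3\<^esub> ?H"
    unfolding complete_bipartite_digraph_def using gr ends by blast
  then show False using ind assms(1) unfolding claw_free_def by blast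
qed

text \<open>A cycle is a list of arcs, so one arc is chosen for each consecutive pair of the closed
  vertex list; the tails of these arcs are again the entries of \<open>xs\<close>.\<close>

lemma hamiltonianI:
  assumes xs: "distinct xs" "set xs = verts G" "successively (\<lambda>x y. x \<rightarrow>\<^bsub>G\<^esub> y) xs"
    "last xs \<rightarrow>\<^bsub>G\<^esub> hd xs" "length xs \<ge> 3"
  shows "hamiltonian G"
proof -
  have walk: "\<exists>p. awalk x p y \<and> awalk_verts x p = x # ys @ [y]"
    if "successively (\<lambda>x y. x \<rightarrow>\<^bsub>G\<^esub> y) (x # ys @ [y])" for x y ys
    using that
  proof (induction ys arbitrary: x)
    case Nil
    then obtain e where "e \<in> arcs G" "tail G e = x" "head G e = y" by auto
    then show ?case by (intro exI[of _ "[e]"]) (auto simp: awalk_def)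
  next
    case (Cons z zs)
    then obtain p where p: "awalk z p y" "awalk_verts z p = z # zs @ [y]" by auto
    obtain e where "e \<in> arcs G" "tail G e = x" "head G e = z" using Cons.prems by auto
    then show ?case using p by (intro exI[of _ "e # p"]) (auto simp: awalk_Cons_iff)
  qed
  obtain x ys where x: "xs = x # ys" using xs by (cases xs) auto
  have "successively (\<lambda>x y. x \<rightarrow>\<^bsub>G\<^esub> y) (xs @ [x])"
    unfolding successively_append_iff using xs(3,4) x by simp
  then have "successively (\<lambda>x y. x \<rightarrow>\<^bsub>G\<^esub> y) (x # ys @ [x])" using x by simp
  then obtain p where p: "awalk x p x" "awalk_verts x p = x # ys @ [x]" using walk by blast
  have len: "length p = length xs" using length_awalk_verts[of x p] p x by simp
  then have "p \<noteq> []" using xs by auto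
  then have "map (tail G) p @ [head G (last p)] = xs @ [x]"
    using p(2) x awalk_verts_conv[of x p] by simp
  then have "tail G ` set p = verts G" using xs(2) by (metis append1_eq_conv set_map)
  moreover have "cycle p" unfolding cycle_def using p \<open>p \<noteq> []\<close> xs(1) x by auto
  ultimately show ?thesis using len xs(5) by (auto simp: hamiltonian_def)
qed

lemma connected_dominating_pairI:
  assumes "x \<rightarrow>\<^bsub>G\<^esub> y" "\<And>w. w \<in> verts G \<Longrightarrow> w = x \<or> w = y \<or> x \<rightarrow>\<^bsub>G\<^esub> w \<or> y \<rightarrow>\<^bsub>G\<^esub> w"
  shows "connected_dominating_set G {x, y}"
  unfolding connected_dominating_set_def
proof (intro conjI ballI connected_induce_pair[OF assms(1)])
  show "{x, y} \<subseteq> verts G" using assms(1) by auto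
  fix w assume "w \<in> verts G - {x, y}"
  then show "\<exists>d\<in>{x, y}. w \<rightarrow>\<^bsub>G\<^esub> d" using assms(2)[of w] adj_sym by auto
qed

section \<open>An almost dominating edge from criticality\<close>

text \<open>A connected dominating set with at most two vertices after deleting \<open>v\<close>
  must be an edge, and the endpoints of an edge never dominate \<open>G\<close>, as that would give
  \<open>\<gamma>\<^sub>c G\<close> at most two.\<close>

lemma almost_dominating_edge_exists:
  assumes crit: "gamma_c_vertex_critical 3 G" and v: "v \<in> verts G" and vu: "v \<rightarrow>\<^bsub>G\<^esub> u"
  obtains a b where "\<not> a \<rightarrow>\<^bsub>G\<^esub> v" "\<not> b \<rightarrow>\<^bsub>G\<^esub> v" "a \<noteq> v" "b \<noteq> v" "a \<rightarrow>\<^bsub>G\<^esub> b"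
    "\<And>x. x \<in> verts G \<Longrightarrow> x = v \<or> x = a \<or> x = b \<or> a \<rightarrow>\<^bsub>G\<^esub> x \<or> b \<rightarrow>\<^bsub>G\<^esub> x"
    "\<exists>x. a \<rightarrow>\<^bsub>G\<^esub> x \<and> \<not> b \<rightarrow>\<^bsub>G\<^esub> x \<and> x \<noteq> b" "\<exists>x. b \<rightarrow>\<^bsub>G\<^esub> x \<and> \<not> a \<rightarrow>\<^bsub>G\<^esub> x \<and> x \<noteq> a"
proof -
  have no_pair: "\<exists>w\<in>verts G. w \<noteq> x \<and> w \<noteq> y \<and> \<not> x \<rightarrow>\<^bsub>G\<^esub> w \<and> \<not> y \<rightarrow>\<^bsub>G\<^esub> w" if "x \<rightarrow>\<^bsub>G\<^esub> y" for x y
  proof (rule ccontr)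
    assume "\<not> ?thesis"
    then have "connected_dominating_set G {x, y}" using connected_dominating_pairI[OF that] by blast
    then have "enat 3 \<le> enat (card {x, y})"
      using connected_domination_number_le crit by (metis gamma_c_vertex_critical_def)
    moreover have "card {x, y} \<le> 2" by (simp add: card_insert_if)
    ultimately show False by simp
  qed
  \<comment> \<open>If \<open>x\<close> dominated everything but \<open>v\<close>, then the edge
    from \<open>x\<close> to the neighbour \<open>u\<close> of \<open>v\<close>, or the edge from
    \<open>v\<close> to \<open>u\<close> if \<open>u = x\<close>, would dominate
    \<open>G\<close>.\<close>
  have no_dom: "\<exists>w\<in>verts G. w \<noteq> v \<and> w \<noteq> x \<and> \<not> x \<rightarrow>\<^bsub>G\<^esub> w" if "x \<in> verts G" "x \<noteq> v" for x
  proof (rule ccontr)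
    assume neg: "\<not> ?thesis"
    have "u \<in> verts G" "u \<noteq> v" using vu adj_not_same by auto
    then have "u = x \<or> x \<rightarrow>\<^bsub>G\<^esub> u" using neg by blast
    then show False
    proof
      assume "u = x"
      then show False using neg no_pair[OF vu] by blast
    next
      assume "x \<rightarrow>\<^bsub>G\<^esub> u"
      from no_pair[OF this] show False using neg adj_sym[OF vu] by metis
    qed
  qed
  have "\<gamma>\<^sub>c (del_vert v) < enat 3" using crit v by (auto simp: gamma_c_vertex_critical_def)
  then obtain D where D: "connected_dominating_set (del_vert v) D" "card D < 3"
    by (rule connected_domination_number_less)
  have adj_del: "x \<rightarrow>\<^bsub>del_vert v\<^esub> y \<Longrightarrow> x \<rightarrow>\<^bsub>G\<^esub> y" for x y
    by (auto simp: arcs_ends_conv del_vert_simps)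
  have DV: "D \<subseteq> verts G - {v}" using D(1) by (auto simp: connected_dominating_set_def verts_del_vert)
  have dom: "x \<in> D \<or> (\<exists>d\<in>D. d \<rightarrow>\<^bsub>G\<^esub> x)" if "x \<in> verts G" "x \<noteq> v" for x
  proof (cases "x \<in> D")
    case False
    then have "x \<in> verts (del_vert v) - D" using that by (simp add: verts_del_vert)
    then obtain d where "d \<in> D" "x \<rightarrow>\<^bsub>del_vert v\<^esub> d"
      using D(1) unfolding connected_dominating_set_def by meson
    then show ?thesis using adj_sym[OF adj_del[of x d]] by auto
  qed simp
  have con: "Digraph_Component.connected (del_vert v \<restriction> D)"
    using D(1) by (auto simp: connected_dominating_set_def)
  have "finite D" using DV finite_verts finite_subset by blast
  obtain a where a: "a \<in> D" using con by (auto simp: connected_def strongly_connected_def)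
  have aV: "a \<in> verts G" "a \<noteq> v" using a DV by auto
  obtain b where b: "b \<in> D" "b \<noteq> a"
    using no_dom[OF aV] dom a by blast
  have "card {a, b} = 2" using b by simp
  then have "D = {a, b}"
    using card_seteq[OF \<open>finite D\<close>, of "{a, b}"] a b D(2) by auto
  have "symmetric (del_vert v)"
    using sym_arcs by (fastforce simp: symmetric_conv del_vert_simps)
  then obtain p q where "p \<in> {a}" "q \<in> D - {a}" "p \<rightarrow>\<^bsub>del_vert v\<^esub> q"
    using connected_crossing_arc[OF con, of "{a}"] a b by blast
  then have ab: "a \<rightarrow>\<^bsub>G\<^esub> b" using adj_del \<open>D = {a, b}\<close> by blast
  have bV: "b \<in> verts G" "b \<noteq> v" using b DV by auto
  have dom': "x = v \<or> x = a \<or> x = b \<or> a \<rightarrow>\<^bsub>G\<^esub> x \<or> b \<rightarrow>\<^bsub>G\<^esub> x" if "x \<in> verts G" for x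
    using dom[OF that] \<open>D = {a, b}\<close> by blast
  show thesis
  proof (rule that)
    \<comment> \<open>The edge misses some vertex, and only \<open>v\<close> can be missed.\<close>
    show "\<not> a \<rightarrow>\<^bsub>G\<^esub> v" "\<not> b \<rightarrow>\<^bsub>G\<^esub> v" using no_pair[OF ab] dom' by blast+
    \<comment> \<open>A vertex other than \<open>v\<close> that \<open>b\<close> fails to dominate
      must be dominated by \<open>a\<close>.\<close>
    show "\<exists>x. a \<rightarrow>\<^bsub>G\<^esub> x \<and> \<not> b \<rightarrow>\<^bsub>G\<^esub> x \<and> x \<noteq> b" using no_dom[OF bV] dom' ab adj_sym[OF ab] by blast
    show "\<exists>x. b \<rightarrow>\<^bsub>G\<^esub> x \<and> \<not> a \<rightarrow>\<^bsub>G\<^esub> x \<and> x \<noteq> a" using no_dom[OF aV] dom' ab by blast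
  qed (use aV bV ab dom' in auto)
qed

end

section \<open>Verification of the locale hypotheses and transfer of the cycle\<close>

theorem theorem3p7:
  fixes G :: "('a, 'b) pre_digraph"
  assumes "graph G"
    and "vertex_connected 2 G"
    and "gamma_c_vertex_critical 3 G"
    and "claw_free G"
  shows "hamiltonian G"
proof -
  interpret graph G by fact
  let ?E = "\<lambda>x y. x \<rightarrow>\<^bsub>G\<^esub> y"
  have card: "card (verts G) > 2" using assms(2) by (simp add: vertex_connected_def)
  have cut: "\<exists>p\<in>X. \<exists>q\<in>verts G - {x} - X. ?E p q"
    if "x \<in> verts G" "X \<subseteq> verts G - {x}" "X \<noteq> {}" "X \<noteq> verts G - {x}" for x X
  proof -
    have "Digraph_Component.connected (G \<restriction> (verts G - {x}))"
      using assms(2) that(1) unfolding vertex_connected_def by auto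
    then show ?thesis
      using connected_crossing_arc[OF _ that(2-4) sym_arcs] by metis
  qed
  obtain v where v: "v \<in> verts G" using card by fastforce
  obtain x y where xy: "x \<in> verts G" "x \<noteq> v" "y \<in> verts G" "y \<noteq> v" "y \<noteq> x"
  proof -
    have "\<not> verts G \<subseteq> {v}" using card card_mono[of "{v}" "verts G"] by auto
    then obtain x where x: "x \<in> verts G" "x \<noteq> v" by auto
    have "\<not> verts G \<subseteq> {v, x}" using card card_mono[of "{v, x}" "verts G"] x by auto
    then show thesis using that x by auto
  qed
  \<comment> \<open>After deleting \<open>x\<close>, the vertex \<open>y\<close> still remains
    besides \<open>v\<close>, so an edge leaves \<open>v\<close>.\<close>
  obtain u where u: "?E v u" using cut[of x "{v}"] v xy by auto
  obtain a b where ab: "\<not> ?E a v" "\<not> ?E b v" "a \<noteq> v" "b \<noteq> v" "?E a b"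
    "\<And>x. x \<in> verts G \<Longrightarrow> x = v \<or> x = a \<or> x = b \<or> ?E a x \<or> ?E b x"
    "\<exists>x. ?E a x \<and> \<not> ?E b x \<and> x \<noteq> b" "\<exists>x. ?E b x \<and> \<not> ?E a x \<and> x \<noteq> a"
    by (rule almost_dominating_edge_exists[OF assms(3) v u]) (rule that)
  interpret simple_graph "verts G" ?E by (rule simple_graph_verts)
  interpret almost_dominating_edge "verts G" ?E v a b
  proof unfold_locales
    show "?E x y \<or> ?E y z \<or> ?E x z"
      if "?E c x" "?E c y" "?E c z" "x \<noteq> y" "y \<noteq> z" "x \<noteq> z" for c x y z
      using claw_free_adj[OF assms(4) that] .
  qed (fact cut v ab)+
  from spanning_cycle obtain p q where "spanning_path (verts G) p q" "?E q p"
    by (auto simp: spanning_cycle_def)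
  then obtain xs where xs: "distinct xs" "set xs = verts G" "successively ?E xs"
    "?E (last xs) (hd xs)" by (auto simp: spanning_path_def)
  \<comment> \<open>The bound on the number of vertices supplies the length of at least
    three.\<close>
  then show ?thesis using hamiltonianI card distinct_card[of xs] by fastforce
qed

end
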